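(* For every acute triangle $ABC$ with $a<b<c$, letting $t_n$ denote the signed distance from $\mathrm{Atrace}(X_n)$ to $C$, we have $$t_{20}>t_{22}>t_3>t_8>t_9>t_{21}>t_{10}>t_2>t_1>t_{17}>t_{12}>t_7>t_{13}>t_{29}>t_4>t_{27}>t_{19}>t_{28}>t_{25}>t_{24}>t_{23}.$$ Equivalently, in the trace order, $X_{20}\prec X_{22}\prec X_3\prec X_8\prec X_9\prec X_{21}\prec X_{10}\prec X_2\prec X_1\prec X_{17}\prec X_{12}\prec X_7\prec X_{13}\prec X_{29}\prec X_4\prec X_{27}\prec X_{19}\prec X_{28}\prec X_{25}\prec X_{24}\prec X_{23}$.
   Context: $X_n$ denotes the $n$-th triangle center listed in Kimberling's Encyclopedia of Triangle Centers (ETC), given by barycentric coordinates in terms of $a=BC$, $b=CA$, $c=AB$. For a point $P\ne A$, $\mathrm{Atrace}(P)$ is the intersection of line $AP$ with line $BC$ (for $P=(p:q:r)$ it is $(0:q:r)$). For a point $X$ on line $BC$, the signed distance from $X$ to $C$ is the distance $XC$ if $X$ lies on the ray from $C$ through $B$, and $-XC$ if $X$ lies on the extension of $BC$ beyond $C$; for $P=(p:q:r)$ this equals $aq/(q+r)$. The trace order is defined by: $P\prec Q$ if the signed distance from $\mathrm{Atrace}(P)$ to $C$ is greater than that of $\mathrm{Atrace}(Q)$ in every acute triangle $ABC$ with $a<b<c$. *)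

theory Defs
  imports Complex_Main
begin

text \<open>Triangle with side lengths a = BC, b = CA, c = AB.  The angle at A
  (opposite side a), via the law of cosines.\<close>
definition angA :: "real \<Rightarrow> real \<Rightarrow> real \<Rightarrow> real" where
  "angA a b c = arccos ((b^2 + c^2 - a^2) / (2 * b * c))"

text \<open>First barycentric coordinate f(a,b,c) of the ETC centre X(n), for the
  centres used below (ETC conventions; trilinears t(a,b,c) are converted to
  barycentrics a * t(a,b,c)).  The full barycentrics are
  (f(a,b,c) : f(b,c,a) : f(c,a,b)).  Other indices are irrelevant (value 0).\<close>
definition etc_first :: "nat \<Rightarrow> real \<Rightarrow> real \<Rightarrow> real \<Rightarrow> real" where
  "etc_first n a b c =
    (let A = angA a b c; B = angA b c a; C = angA c a b in
     if n = 1 then a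
     else if n = 2 then 1
     else if n = 3 then a^2 * (b^2 + c^2 - a^2)
     else if n = 4 then tan A
     else if n = 7 then 1 / (b + c - a)
     else if n = 8 then b + c - a
     else if n = 9 then a * (b + c - a)
     else if n = 10 then b + c
     else if n = 12 then (b + c)^2 / (b + c - a)
     else if n = 13 then a / sin (A + pi / 3)
     else if n = 17 then a / sin (A + pi / 6)
     else if n = 19 then a * tan A
     else if n = 20 then 3 * a^4 - 2 * a^2 * (b^2 + c^2) - (b^2 - c^2)^2
     else if n = 21 then a / (cos B + cos C)
     else if n = 22 then a^2 * (b^4 + c^4 - a^4)
     else if n = 23 then a^2 * (b^4 + c^4 - a^4 - b^2 * c^2)
     else if n = 24 then a * cos (2 * A) / cos A
     else if n = 25 then a * sin A * tan A
     else if n = 27 then a / (cos A * (b + c))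
     else if n = 28 then a * tan A / (b + c)
     else if n = 29 then a / (cos A * (cos B + cos C))
     else 0)"

definition etc_center :: "nat \<Rightarrow> real \<Rightarrow> real \<Rightarrow> real \<Rightarrow> real \<times> real \<times> real" where
  "etc_center n a b c = (etc_first n a b c, etc_first n b c a, etc_first n c a b)"

text \<open>Signed distance from Atrace(P) = (0 : q : r) to C, for P = (p : q : r):
  a q / (q + r).\<close>
definition atrace_signed_dist :: "real \<Rightarrow> real \<times> real \<times> real \<Rightarrow> real" where
  "atrace_signed_dist a P = (case P of (p, q, r) \<Rightarrow> a * q / (q + r))"

definition acute_abc :: "real \<Rightarrow> real \<Rightarrow> real \<Rightarrow> bool" where
  "acute_abc a b c \<longleftrightarrow> 0 < a \<and> 0 < b \<and> 0 < c \<and> a < b + c \<and> b < c + a \<and> c < a + b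
     \<and> a^2 < b^2 + c^2 \<and> b^2 < c^2 + a^2 \<and> c^2 < a^2 + b^2"

definition trace_prec :: "nat \<Rightarrow> nat \<Rightarrow> bool" where
  "trace_prec m n \<longleftrightarrow> (\<forall>a b c. acute_abc a b c \<and> a < b \<and> b < c \<longrightarrow>
      atrace_signed_dist a (etc_center m a b c) > atrace_signed_dist a (etc_center n a b c))"

end

theory Submission
  imports Defs
begin

text \<open>
  With Conway's x, y, z (the products of two sides with the cosine of the enclosed angle) and S twice
  the area, the B- and C-coordinates of each centre become, up to a common factor, algebraic
  expressions in the sides and x, y, z, S, and a comparison of two traces becomes a single inequality
  between products. The difference of the two sides always contains the factor c - b, or y - z where
  only squares of sides occur. The cofactor is visibly positive except for X(13) and X(17), where
  the bounds a (a + b + c) < 2 sqrt 3 S < 3 a (b + c - a) suffice.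
\<close>

section \<open>Comparing traces; sine and cosine of an arccosine\<close>

lemma atrace_signed_dist_scale:
  assumes "k \<noteq> 0" "q' = k * q" "r' = k * r"
  shows "atrace_signed_dist a (p', q', r') = atrace_signed_dist a (p, q, r)"
proof -
  have "a * q' / (q' + r') = (k * (a * q)) / (k * (q + r))"
    by (simp add: assms algebra_simps)
  also have "\<dots> = a * q / (q + r)" using assms(1) by simp
  finally show ?thesis by (simp add: atrace_signed_dist_def)
qed

text \<open>Cross-multiplication of two fractions with positive denominators. Only the sums of
  coordinates must be positive: single coordinates of X(20), X(22) and X(23) can be
  negative.\<close>

lemma atrace_signed_dist_less:
  assumes "0 < a" "0 < q + r" "0 < q' + r'" "q' * r < q * r'"
  shows "atrace_signed_dist a (p', q', r') < atrace_signed_dist a (p, q, r)"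
proof -
  have "a * (q' * r) < a * (q * r')" using assms by simp
  then have "(a * q') * (q + r) < (a * q) * (q' + r')" by (simp add: algebra_simps)
  then show ?thesis
    using assms by (simp add: atrace_signed_dist_def mult.commute pos_divide_less_eq pos_less_divide_eq)
qed

text \<open>For two sides \<open>k\<close>, \<open>l\<close> of a triangle, \<open>w\<close> plays
  the inner product and \<open>t\<close> twice the area. The last hypothesis is cos^2 + sin^2 = 1
  with denominators cleared: it puts the quotient into [-1, 1], and \<open>t > 0\<close> selects the
  positive root for the sine.\<close>

lemma cos_sin_arccos:
  fixes k l w t :: real
  assumes "0 < k" "0 < l" "0 < t" "w^2 + t^2 = (k * l)^2"
  shows "cos (arccos (w / (k * l))) = w / (k * l)" "sin (arccos (w / (k * l))) = t / (k * l)"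
proof -
  have kl: "0 < k * l" using assms by simp
  have "w^2 \<le> (k * l)^2" using assms(4) zero_le_power2[of t] by linarith
  then have "\<bar>w\<bar> \<le> k * l" using kl by (simp add: abs_le_square_iff[symmetric])
  then have b: "-1 \<le> w / (k * l)" "w / (k * l) \<le> 1" using kl by (auto simp: field_simps abs_le_iff)
  show "cos (arccos (w / (k * l))) = w / (k * l)" using b by simp
  have "1 - (w / (k * l))^2 = (t / (k * l))^2"
    using assms by (simp add: power_divide field_simps)
  then have "sqrt (1 - (w / (k * l))^2) = t / (k * l)"
    using kl assms(3) by (simp add: real_sqrt_unique)
  then show "sin (arccos (w / (k * l))) = t / (k * l)" using b by (simp add: sin_arccos)
qed

section \<open>Conway's notation: sides, area and angles\<close>

locale acute_triangle =
  fixes a b c :: real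
  assumes acute: "acute_abc a b c"
begin

definition "x = (b^2 + c^2 - a^2) / 2"
definition "y = (c^2 + a^2 - b^2) / 2"
definition "z = (a^2 + b^2 - c^2) / 2"
text \<open>Heron's formula in Conway's form.\<close>

definition "S = sqrt (x * y + y * z + z * x)"
text \<open>\<open>u\<close>, \<open>v\<close>, \<open>w\<close> are twice the tangent lengths from
  B, C, A to the incircle.\<close>

definition "u = c + a - b"
definition "v = a + b - c"
definition "w = b + c - a"

lemma pos [simp]: "0 < a" "0 < b" "0 < c" "0 < x" "0 < y" "0 < z" "0 < u" "0 < v" "0 < w"
  using acute by (auto simp: acute_abc_def x_def y_def z_def u_def v_def w_def)

lemma nonzero [simp]: "a \<noteq> 0" "b \<noteq> 0" "c \<noteq> 0" "x \<noteq> 0" "y \<noteq> 0" "z \<noteq> 0" "u \<noteq> 0" "v \<noteq> 0"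
  "w \<noteq> 0"
  using pos by (metis less_irrefl)+

lemma nonneg [simp]: "0 \<le> a" "0 \<le> b" "0 \<le> c" "0 \<le> w"
  using pos by (simp_all only: less_imp_le)

lemma side_sq: "a^2 = y + z" "b^2 = z + x" "c^2 = x + y"
  by (simp_all add: x_def y_def z_def field_simps)

lemma S_pos [simp]: "0 < S"
  by (simp add: S_def add_pos_pos)

lemma S_nonneg [simp]: "0 \<le> S"
  using S_pos by (rule less_imp_le)

lemma S_nonzero [simp]: "S \<noteq> 0"
  using S_pos by linarith

lemma S_sq: "S^2 = x * y + y * z + z * x"
  using add_pos_pos[OF add_pos_pos, of "x * y" "y * z" "z * x"] by (simp add: S_def)

text \<open>Heron's formula arranged by \<open>b + c\<close> and \<open>c - b\<close>, the form from
  which the bounds on \<open>S\<close> are derived.\<close>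

lemma S_sq_sides: "4 * S^2 = ((b + c)^2 - a^2) * (a^2 - (c - b)^2)"
  unfolding S_sq x_def y_def z_def by (simp add: field_simps power2_eq_square)

lemma angA_eq: "angA a b c = arccos (x / (b * c))" "angA b c a = arccos (y / (c * a))"
  "angA c a b = arccos (z / (a * b))"
  by (simp_all add: angA_def x_def y_def z_def mult.assoc)

lemma S_norm: "x^2 + S^2 = (b * c)^2" "y^2 + S^2 = (c * a)^2" "z^2 + S^2 = (a * b)^2"
  unfolding S_sq power_mult_distrib side_sq by (simp_all add: power2_eq_square algebra_simps)

lemma cos_angA: "cos (angA a b c) = x / (b * c)" "cos (angA b c a) = y / (c * a)"
    "cos (angA c a b) = z / (a * b)"
  unfolding angA_eq by (rule cos_sin_arccos[where t = S]; simp add: S_norm)+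

lemma sin_angA: "sin (angA b c a) = S / (c * a)" "sin (angA c a b) = S / (a * b)"
  unfolding angA_eq by (rule cos_sin_arccos; simp add: S_norm)+

lemma tan_angA: "tan (angA b c a) = S / y" "tan (angA c a b) = S / z"
  by (simp_all add: tan_def sin_angA cos_angA)

text \<open>The numerators factor because \<open>b^2 - (c - a)^2 = w * v\<close>, and similarly for
  the other sum. This makes the coordinates of X(21) and X(29) products.\<close>

lemma cos_sum:
  "cos (angA c a b) + cos (angA a b c) = (c + a) * w * v / (2 * a * b * c)"
  "cos (angA a b c) + cos (angA b c a) = (a + b) * w * u / (2 * a * b * c)"
  unfolding cos_angA x_def y_def z_def u_def v_def w_def
  by (simp_all add: field_simps power2_eq_square)

lemma sin_angA_60:
  "sin (angA b c a + pi / 3) = (S + sqrt 3 * y) / (2 * c * a)"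
  "sin (angA c a b + pi / 3) = (S + sqrt 3 * z) / (2 * a * b)"
  unfolding sin_add sin_angA cos_angA sin_60 cos_60 by (simp_all add: field_simps)

lemma sin_angA_30:
  "sin (angA b c a + pi / 6) = (sqrt 3 * S + y) / (2 * c * a)"
  "sin (angA c a b + pi / 6) = (sqrt 3 * S + z) / (2 * a * b)"
  unfolding sin_add sin_angA cos_angA sin_30 cos_30 by (simp_all add: field_simps)

section \<open>Algebraic B- and C-coordinates of the centres\<close>

definition "t n = atrace_signed_dist a (etc_center n a b c)"

text \<open>The trace ignores the A-coordinate, so 0 serves as a placeholder and only the values at
  B and C have to be computed, up to the common factor \<open>k\<close>.\<close>

lemma t_eqI:
  assumes "k \<noteq> 0" "etc_first n b c a = k * q" "etc_first n c a b = k * r"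
  shows "t n = atrace_signed_dist a (0, q, r)"
  unfolding t_def etc_center_def using assms by (rule atrace_signed_dist_scale)

lemma sums_pos [simp]: "0 < sqrt 3 * S + y" "0 < sqrt 3 * S + z" "0 < S + sqrt 3 * y" "0 < S + sqrt 3 * z"
  "0 < a + b" "0 < c + a" "0 < b + c" "0 < a + b + c"
  by (simp_all add: add_pos_pos)

lemma sums_nonzero [simp]: "sqrt 3 * S + y \<noteq> 0" "sqrt 3 * S + z \<noteq> 0" "S + sqrt 3 * y \<noteq> 0"
  "S + sqrt 3 * z \<noteq> 0" "a + b \<noteq> 0" "c + a \<noteq> 0"
  using sums_pos by (metis less_irrefl)+

lemma t_1: "t 1 = atrace_signed_dist a (0, b, c)"
  by (rule t_eqI[of 1]) (simp_all add: etc_first_def)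

lemma t_2: "t 2 = atrace_signed_dist a (0, 1, 1)"
  by (rule t_eqI[of 1]) (simp_all add: etc_first_def)

lemma t_3: "t 3 = atrace_signed_dist a (0, b^2 * y, c^2 * z)"
  by (rule t_eqI[of 2]) (simp_all add: etc_first_def y_def z_def)

lemma t_4: "t 4 = atrace_signed_dist a (0, z, y)"
  by (rule t_eqI[of "S / (y * z)"]) (simp_all add: etc_first_def tan_angA)

lemma t_7: "t 7 = atrace_signed_dist a (0, v, u)"
  by (rule t_eqI[of "1 / (u * v)"]) (simp_all add: etc_first_def, simp_all add: u_def v_def)

lemma t_8: "t 8 = atrace_signed_dist a (0, u, v)"
  by (rule t_eqI[of 1]) (simp_all add: etc_first_def u_def v_def)

lemma t_9: "t 9 = atrace_signed_dist a (0, b * u, c * v)"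
  by (rule t_eqI[of 1]) (simp_all add: etc_first_def u_def v_def)

lemma t_10: "t 10 = atrace_signed_dist a (0, c + a, a + b)"
  by (rule t_eqI[of 1]) (simp_all add: etc_first_def)

lemma t_12: "t 12 = atrace_signed_dist a (0, (c + a)^2 * v, (a + b)^2 * u)"
  by (rule t_eqI[of "1 / (u * v)"]) (simp_all add: etc_first_def, simp_all add: u_def v_def)

lemma t_13: "t 13 = atrace_signed_dist a (0, S + sqrt 3 * z, S + sqrt 3 * y)"
  by (rule t_eqI[of "2 * a * b * c / ((S + sqrt 3 * y) * (S + sqrt 3 * z))"])
    (simp_all add: etc_first_def sin_angA_60)

lemma t_17: "t 17 = atrace_signed_dist a (0, sqrt 3 * S + z, sqrt 3 * S + y)"
  by (rule t_eqI[of "2 * a * b * c / ((sqrt 3 * S + y) * (sqrt 3 * S + z))"])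
    (simp_all add: etc_first_def sin_angA_30)

lemma t_19: "t 19 = atrace_signed_dist a (0, b * z, c * y)"
  by (rule t_eqI[of "S / (y * z)"]) (simp_all add: etc_first_def tan_angA)

lemma t_20: "t 20 = atrace_signed_dist a (0, x * y + y * z - z * x, z * x + y * z - x * y)"
  \<comment> \<open>The negative factor makes the sum of the two coordinates positive for a < b < c,
    as \<open>atrace_signed_dist_less\<close> demands; likewise in \<open>t_23\<close> and
    \<open>t_24\<close>.\<close>
  by (rule t_eqI[of "-4"])
    (simp_all add: etc_first_def x_def y_def z_def field_simps power2_eq_square power4_eq_xxxx)

lemma t_21: "t 21 = atrace_signed_dist a (0, b * u * (a + b), c * v * (c + a))"
  by (rule t_eqI[of "2 * a * b * c / (w * u * v * (a + b) * (c + a))"])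
    (simp_all add: etc_first_def cos_sum mult_ac)

lemma t_22: "t 22 = atrace_signed_dist a
    (0, b^2 * (y^2 + x * y + y * z - z * x), c^2 * (z^2 + z * x + y * z - x * y))"
  by (rule t_eqI[of 2])
    (simp_all add: etc_first_def x_def y_def z_def field_simps power2_eq_square power4_eq_xxxx)

lemma t_23: "t 23 = atrace_signed_dist a
    (0, b^2 * (3 * z * x - y^2 - x * y - y * z), c^2 * (3 * x * y - z^2 - z * x - y * z))"
  by (rule t_eqI[of "-1"])
    (simp_all add: etc_first_def x_def y_def z_def field_simps power2_eq_square power4_eq_xxxx)

lemma t_24: "t 24 = atrace_signed_dist a
    (0, b^2 * z * (c^2 * a^2 - 2 * y^2), c^2 * y * (a^2 * b^2 - 2 * z^2))"
  by (rule t_eqI[of "- 1 / (a * b * c * y * z)"])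
    (simp_all add: etc_first_def cos_double_cos cos_angA field_simps power2_eq_square)

lemma t_25: "t 25 = atrace_signed_dist a (0, b^2 * z, c^2 * y)"
  by (rule t_eqI[of "S^2 / (a * b * c * y * z)"])
    (simp_all add: etc_first_def sin_angA tan_angA power2_eq_square ac_simps)

lemma t_27: "t 27 = atrace_signed_dist a (0, z * (a + b), y * (c + a))"
  by (rule t_eqI[of "a * b * c / (y * z * (a + b) * (c + a))"])
    (simp_all add: etc_first_def cos_angA)

lemma t_28: "t 28 = atrace_signed_dist a (0, b * z * (a + b), c * y * (c + a))"
  by (rule t_eqI[of "S / (y * z * (a + b) * (c + a))"])
    (simp_all add: etc_first_def tan_angA)

lemma t_29: "t 29 = atrace_signed_dist a (0, z * (a + b) * u, y * (c + a) * v)"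
  by (rule t_eqI[of "2 * (a * b * c)^2 / (y * z * (a + b) * (c + a) * w * u * v)"])
    (simp_all add: etc_first_def cos_sum, simp_all add: cos_angA power2_eq_square ac_simps)

end


section \<open>Bounds on the area for a < b < c\<close>

locale ordered_acute_triangle = acute_triangle +
  assumes ab: "a < b" and bc: "b < c"
begin

lemma xyz_order: "y < x" "z < y"
proof -
  have "a^2 < b^2" "b^2 < c^2"
    using ab bc pos(1-3) by (auto intro!: power_strict_mono less_imp_le)
  then show "y < x" "z < y" by (simp_all add: x_def y_def z_def)
qed

text \<open>This is \<open>z > 0\<close>, the acuteness of the angle at C.\<close>

lemma diff_times_sum_less: "(c - b) * (b + c) < a^2"
  using pos(6) by (simp add: z_def power2_eq_square algebra_simps)

text \<open>What \<open>S_lower\<close> becomes after squaring, inserting Heron's formula and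
  cancelling \<open>a + b + c\<close>. Two bounds on \<open>d\<close> are available:
  \<open>d < e\<close>, which is \<open>a < b\<close>, and \<open>d * s < a^2\<close>, which is
  acuteness.\<close>

lemma diff_sq_bound: "3 * (b + c - a) * (c - b)^2 < 2 * a^2 * (b + c - 2 * a)"
proof -
  define s d e where "s = b + c" and "d = c - b" and "e = b + c - 2 * a"
  have s: "0 < s" and d: "0 < d" and e: "0 < e" and de: "d < e" and sa: "0 < s - a"
    using ab bc pos(1-3) unfolding s_def d_def e_def by linarith+
  have ds: "d * s < a^2" using diff_times_sum_less by (simp add: s_def d_def)
  have "3 * (s - a) * d^2 < 2 * a^2 * e"
  proof (cases "s \<le> 3 * a")
    \<comment> \<open>Here \<open>3 * (s - a) <= 2 * s\<close>. One factor \<open>d\<close> is spent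
      on \<open>d * s < a^2\<close>, the other on \<open>d < e\<close>, since \<open>e\<close> tends
      to 0 near the equilateral triangle.\<close>
    case True
    have "(3 * (s - a) * d^2) * s = 3 * (s - a) * ((d * s) * d)"
      by (simp add: power2_eq_square)
    also have "\<dots> < 3 * (s - a) * (a^2 * e)"
      using sa ds de d s by (intro mult_strict_left_mono mult_strict_mono) auto
    also have "\<dots> \<le> (2 * s) * (a^2 * e)"
      using True e by (intro mult_right_mono) auto
    finally have "(3 * (s - a) * d^2) * s < (2 * a^2 * e) * s" by (simp add: ac_simps)
    then show ?thesis using s by simp
  next
    \<comment> \<open>Here \<open>e > a\<close>, so both factors \<open>d\<close> can be spent on
      \<open>d * s < a^2\<close>.\<close>
    case False
    have "(3 * (s - a) * d^2) * s^2 = 3 * (s - a) * (d * s)^2"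
      by (simp add: power_mult_distrib)
    also have "\<dots> \<le> 3 * (s - a) * (a^2)^2"
      using sa ds d s by (intro mult_left_mono power_mono) auto
    also have "\<dots> < (3 * s) * (a^2)^2"
      using sa by (intro mult_strict_right_mono) auto
    also have "\<dots> = a^2 * (s * a) * (3 * a)" by (simp add: power2_eq_square)
    also have "\<dots> \<le> a^2 * (s * e) * s"
      using False s e by (intro mult_mono mult_nonneg_nonneg) (auto simp: e_def s_def[symmetric])
    also have "\<dots> \<le> (2 * a^2 * e) * s^2" using e s by (simp add: power2_eq_square)
    finally show ?thesis using s by simp
  qed
  then show ?thesis by (simp add: s_def d_def e_def)
qed

text \<open>Both this bound and \<open>S_upper\<close> become equalities at the equilateral
  triangle.\<close>

lemma S_lower: "a * (a + b + c) < 2 * (sqrt 3 * S)"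
proof (rule power2_less_imp_less)
  have "(a + b + c) * a^2 < 3 * (b + c - a) * (a^2 - (c - b)^2)"
    using diff_sq_bound by (simp add: algebra_simps)
  then have "(a + b + c) * ((a + b + c) * a^2) < (a + b + c) * (3 * (b + c - a) * (a^2 - (c - b)^2))"
    using pos(1-3) by (intro mult_strict_left_mono) auto
  also have "\<dots> = 3 * (4 * S^2)"
    unfolding S_sq_sides by (simp add: power2_eq_square algebra_simps)
  finally show "(a * (a + b + c))^2 < (2 * (sqrt 3 * S))^2"
    unfolding power_mult_distrib by (simp add: power2_eq_square mult_ac)
qed simp

text \<open>Heron's formula without the term \<open>(c - b)^2\<close>, combined with
  \<open>a + b + c < 3 * w\<close>, which amounts to \<open>2 * a < b + c\<close>.\<close>

lemma S_upper: "2 * (sqrt 3 * S) < 3 * a * w"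
proof (rule power2_less_imp_less)
  have "(2 * (sqrt 3 * S))^2 = 3 * (4 * S^2)" by (simp add: power_mult_distrib)
  also have "\<dots> = 3 * ((a + b + c) * w) * (a^2 - (c - b)^2)"
    unfolding S_sq_sides w_def by (simp add: power2_eq_square algebra_simps)
  also have "\<dots> \<le> 3 * ((a + b + c) * w) * a^2"
    using pos(1-3) by (intro mult_left_mono) auto
  also have "\<dots> < 3 * (3 * w * w) * a^2"
  proof -
    have "a + b + c < 3 * w" using ab bc by (simp add: w_def)
    then show ?thesis by simp
  qed
  also have "\<dots> = (3 * a * w)^2" by (simp add: power2_eq_square)
  finally show "(2 * (sqrt 3 * S))^2 < (3 * a * w)^2" .
qed simp

section \<open>Comparisons from X(20) to X(1)\<close>

lemma t_20_22: "t 22 < t 20"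
  unfolding t_20 t_22
proof (rule atrace_signed_dist_less)
  let ?q = "x * y + y * z - z * x" and ?r = "z * x + y * z - x * y"
  let ?q' = "b^2 * (y^2 + x * y + y * z - z * x)" and ?r' = "c^2 * (z^2 + z * x + y * z - x * y)"
  have "?q + ?r = 2 * (y * z)" by simp
  then show "0 < ?q + ?r" by simp
  have "?q' + ?r' = 2 * (y * z) * (y + z + 2 * x)"
    unfolding side_sq by (simp add: power2_eq_square algebra_simps)
  then show "0 < ?q' + ?r'" by (simp add: add_pos_pos)
  have "?q * ?r' - ?q' * ?r = 2 * (y * z) * x^2 * (y - z)"
    unfolding side_sq by (simp add: power2_eq_square algebra_simps)
  also have "\<dots> > 0" using xyz_order by simp
  finally show "?q' * ?r < ?q * ?r'" by simp
qed simp

lemma t_22_3: "t 3 < t 22"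
  unfolding t_3 t_22
proof (rule atrace_signed_dist_less)
  let ?q = "b^2 * (y^2 + x * y + y * z - z * x)" and ?r = "c^2 * (z^2 + z * x + y * z - x * y)"
  let ?q' = "b^2 * y" and ?r' = "c^2 * z"
  have "?q + ?r = 2 * (y * z) * (y + z + 2 * x)"
    unfolding side_sq by (simp add: power2_eq_square algebra_simps)
  then show "0 < ?q + ?r" by (simp add: add_pos_pos)
  show "0 < ?q' + ?r'" by (simp add: add_pos_pos)
  have "?q * ?r' - ?q' * ?r = (z + x) * (x * (x + y)) * ((y - z) * (y + z))"
    unfolding side_sq by (simp add: power2_eq_square algebra_simps)
  also have "\<dots> > 0" using xyz_order by (simp add: add_pos_pos)
  finally show "?q' * ?r < ?q * ?r'" by simp
qed simp

lemma t_3_8: "t 8 < t 3"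
  unfolding t_3 t_8
proof (rule atrace_signed_dist_less)
  have sq: "a^2 < b^2" "a^2 < c^2"
    using ab bc pos(1-3) by (auto intro!: power_strict_mono less_imp_le)
  \<comment> \<open>Uses \<open>2 * a^2 < b^2 + c^2\<close> and \<open>2 * a < b + c\<close>. It
    makes the cofactor of \<open>c - b\<close> positive, whose remaining term is the square
    \<open>(c^2 - b^2)^2\<close>.\<close>
  have "a * (b^2 + c^2) < (b + c) * (b^2 + c^2 - a^2)"
  proof -
    have "a * (b^2 + c^2) \<le> a * (2 * (b^2 + c^2 - a^2))"
      using sq by (intro mult_left_mono) auto
    also have "\<dots> = (2 * a) * (b^2 + c^2 - a^2)" by simp
    also have "\<dots> < (b + c) * (b^2 + c^2 - a^2)"
      using ab bc pos(4) by (intro mult_strict_right_mono) (simp_all add: x_def)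
    finally show ?thesis .
  qed
  then have "a * (a * (b^2 + c^2)) < a * ((b + c) * (b^2 + c^2 - a^2))" by simp
  then have *: "0 < a * ((b + c) * (b^2 + c^2 - a^2)) - a^2 * (b^2 + c^2) + (c^2 - b^2)^2"
    by (intro add_pos_nonneg) (auto simp: power2_eq_square)
  have "b^2 * y * v - u * (c^2 * z)
      = (c - b) * (a * ((b + c) * (b^2 + c^2 - a^2)) - a^2 * (b^2 + c^2) + (c^2 - b^2)^2) / 2"
    by (simp add: u_def v_def y_def z_def power2_eq_square field_simps)
  also have "\<dots> > 0" using * bc by simp
  finally show "u * (c^2 * z) < b^2 * y * v" by simp
qed (simp_all add: add_pos_pos)

text \<open>Here and in \<open>t_9_21\<close> the ratio q / r is multiplied by a factor below 1:
  first \<open>b / c\<close>, then \<open>(a + b) / (c + a)\<close>.\<close>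

lemma t_8_9: "t 9 < t 8"
  unfolding t_8 t_9 by (rule atrace_signed_dist_less) (simp_all add: add_pos_pos bc)

lemma t_9_21: "t 21 < t 9"
  unfolding t_9 t_21 by (rule atrace_signed_dist_less) (simp_all add: add_pos_pos bc)

lemma t_21_10: "t 10 < t 21"
  unfolding t_10 t_21
proof (rule atrace_signed_dist_less)
  \<comment> \<open>The cofactor of \<open>c - b\<close> is grouped into three differences, each
    positive because \<open>a\<close> is the shortest side.\<close>
  have "a^2 * c < c^2 * c" "a^2 * b < b^2 * b"
    using ab bc pos(1-3) by (auto intro!: mult_strict_right_mono power_strict_mono less_imp_le)
  moreover have "a * a^2 < a * (b^2 - b * c + c^2)"
  proof (rule mult_strict_left_mono)
    have "a^2 < b^2" using ab pos(1) by (intro power_strict_mono) auto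
    also have "\<dots> < b^2 + c * (c - b)" using bc by simp
    finally show "a^2 < b^2 - b * c + c^2" by (simp add: power2_eq_square algebra_simps)
  qed simp
  ultimately have *: "0 < (c^2 * c - a^2 * c) + (b^2 * b - a^2 * b) + a * (b^2 - b * c + c^2 - a^2)"
    unfolding right_diff_distrib[of a _ "a^2"] by linarith
  have "b * u * (a + b) * (a + b) - (c + a) * (c * v * (c + a))
      = (c - b) * ((c^2 * c - a^2 * c) + (b^2 * b - a^2 * b) + a * (b^2 - b * c + c^2 - a^2))"
    by (simp add: u_def v_def power2_eq_square algebra_simps)
  also have "\<dots> > 0" using * bc by simp
  finally show "(c + a) * (c * v * (c + a)) < b * u * (a + b) * (a + b)" by simp
qed (simp_all add: add_pos_pos)

lemma t_10_2: "t 2 < t 10"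
  unfolding t_2 t_10 by (rule atrace_signed_dist_less) (simp_all add: add_pos_pos bc)

lemma t_2_1: "t 1 < t 2"
  unfolding t_1 t_2 by (rule atrace_signed_dist_less) (simp_all add: add_pos_pos bc)

section \<open>Comparisons from X(1) to X(29)\<close>

lemma t_1_17: "t 17 < t 1"
  unfolding t_1 t_17
proof (rule atrace_signed_dist_less)
  \<comment> \<open>The cofactor of \<open>c - b\<close> needs \<open>S_upper\<close> only in the
    weaker form with \<open>a + b + c\<close> in place of \<open>3 * a\<close>.\<close>
  have "3 * a * w < (a + b + c) * w"
    using ab bc by (intro mult_strict_right_mono) auto
  then have *: "0 < (a + b + c) * w - 2 * (sqrt 3 * S)" using S_upper by linarith
  have "b * (sqrt 3 * S + y) - (sqrt 3 * S + z) * c = (c - b) * ((a + b + c) * w - 2 * (sqrt 3 * S)) / 2"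
    by (simp add: y_def z_def w_def power2_eq_square field_simps)
  also have "\<dots> > 0" using * bc by simp
  finally show "(sqrt 3 * S + z) * c < b * (sqrt 3 * S + y)" by simp
qed (simp_all add: add_pos_pos)

lemma t_17_12: "t 12 < t 17"
  unfolding t_12 t_17
proof (rule atrace_signed_dist_less)
  define s where "s = b + c"
  have s: "0 < s" by (simp add: s_def)
  \<comment> \<open>Both terms with \<open>(c - b)^2\<close> in the cofactor are favourable; without
    them the claim is \<open>S_lower\<close> multiplied by \<open>s * (s + 2 * a)\<close>.\<close>
  have "(s + a) * (a * s * (s + 2 * a) - (c - b)^2 * (2 * s + a)) \<le> (s + a) * (a * s * (s + 2 * a))"
    using s by (intro mult_left_mono) (auto simp: add_nonneg_nonneg)
  also have "\<dots> = a * (a + b + c) * (s * (s + 2 * a))" by (simp add: s_def algebra_simps)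
  also have "\<dots> < 2 * (sqrt 3 * S) * (s * (s + 2 * a))"
    using S_lower s by (intro mult_strict_right_mono) (auto simp: add_pos_pos)
  also have "\<dots> \<le> 2 * (sqrt 3 * S) * (s * (s + 2 * a) + (c - b)^2)"
    by (intro mult_left_mono) auto
  finally have *: "0 < 2 * (sqrt 3 * S) * (s * (s + 2 * a) + (c - b)^2)
      - (s + a) * (a * s * (s + 2 * a) - (c - b)^2 * (2 * s + a))" by simp
  have "(sqrt 3 * S + z) * ((a + b)^2 * u) - (c + a)^2 * v * (sqrt 3 * S + y)
      = (c - b) * (2 * (sqrt 3 * S) * (s * (s + 2 * a) + (c - b)^2)
        - (s + a) * (a * s * (s + 2 * a) - (c - b)^2 * (2 * s + a))) / 4"
    by (simp add: s_def u_def v_def y_def z_def power2_eq_square field_simps)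
  also have "\<dots> > 0" using * bc by simp
  finally show "(c + a)^2 * v * (sqrt 3 * S + y) < (sqrt 3 * S + z) * ((a + b)^2 * u)" by simp
qed (simp_all add: add_pos_pos)

lemma t_12_7: "t 7 < t 12"
  unfolding t_7 t_12
proof (rule atrace_signed_dist_less)
  have "(a + b)^2 < (c + a)^2" using bc pos(1-3) by (intro power_strict_mono) auto
  then have "u * v * (a + b)^2 < u * v * (c + a)^2" by simp
  then show "v * ((a + b)^2 * u) < (c + a)^2 * v * u" by (simp add: ac_simps)
qed (simp_all add: add_pos_pos)

lemma t_7_13: "t 13 < t 7"
  unfolding t_7 t_13
proof (rule atrace_signed_dist_less)
  \<comment> \<open>The cofactor of \<open>c - b\<close> is positive by \<open>S_upper\<close>
    divided by \<open>sqrt 3\<close>.\<close>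
  have "sqrt 3 * (sqrt 3 * (a * w)) = 3 * a * w" by (simp add: mult.assoc[symmetric])
  then have "sqrt 3 * (2 * S) < sqrt 3 * (sqrt 3 * (a * w))" using S_upper by linarith
  then have *: "2 * S < sqrt 3 * (a * w)"
    by (rule mult_left_less_imp_less) simp
  have "v * (S + sqrt 3 * y) - (S + sqrt 3 * z) * u = (c - b) * (sqrt 3 * (a * w) - 2 * S)"
    by (simp add: u_def v_def w_def y_def z_def power2_eq_square field_simps)
  also have "\<dots> > 0" using * bc by simp
  finally show "(S + sqrt 3 * z) * u < v * (S + sqrt 3 * y)" by simp
qed (simp_all add: add_pos_pos)

lemma t_13_29: "t 29 < t 13"
  unfolding t_13 t_29
proof (rule atrace_signed_dist_less)
  \<comment> \<open>\<open>d * K / 2\<close> is the coefficient of \<open>S\<close> in the cross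
    difference (fact \<open>1\<close> below).\<close>
  define s d K where "s = b + c" and "d = c - b" and "K = s * (2 * a^2 + a * s - d^2) - a^2 * (a + s)"
  have s: "0 < s" "2 * a < s" and d: "0 < d" using ab bc by (auto simp: s_def d_def)
  have yz: "4 * (y * z) = a^2 * a^2 - s^2 * d^2"
    by (simp add: s_def d_def y_def z_def power2_eq_square field_simps)
  \<comment> \<open>The goal is \<open>2 * sqrt 3 * (y * z) * (a + s) < S * K\<close>; replacing
    \<open>S\<close> by its bound from \<open>S_lower\<close> and cancelling \<open>a + s\<close>
    leaves this inequality.\<close>
  have K: "6 * (y * z) * 2 \<le> a * K"
  proof -
    \<comment> \<open>By \<open>yz\<close> the left side is \<open>3 * a^4 - 3 * s^2 * d^2\<close>,
      so after expanding \<open>a * K\<close> the estimates \<open>4 * a^2 <= s^2\<close> and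
      \<open>a <= 3 * s\<close> suffice.\<close>
    have "(2 * a) * (2 * a) \<le> s * s" using s by (intro mult_mono) auto
    then have "a^2 * (4 * a^2) \<le> a^2 * s^2"
      by (intro mult_left_mono) (auto simp: power2_eq_square)
    moreover have "a * (s * d^2) \<le> (3 * s) * (s * d^2)"
      using s(2) pos(1) s(1) by (intro mult_right_mono mult_nonneg_nonneg) (linarith | simp)+
    moreover have "0 \<le> a^2 * (a * s)" using s by simp
    moreover have "a * K = a^2 * (a * s) + a^2 * s^2 - a * (s * d^2) - a^2 * a^2"
      by (simp add: K_def power2_eq_square algebra_simps)
    moreover have "(3 * s) * (s * d^2) = 3 * (s^2 * d^2)" "a^2 * (4 * a^2) = 4 * (a^2 * a^2)"
      by (simp_all add: power2_eq_square)
    ultimately show ?thesis using yz by linarith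
  qed
  have "0 < 6 * (y * z) * 2" by simp
  with K have "0 < K" using pos(1) by (metis less_le_trans zero_less_mult_pos)
  have "sqrt 3 * (2 * sqrt 3 * (y * z) * (a + s)) = (sqrt 3 * sqrt 3) * (2 * (y * z) * (a + s))"
    by (simp only: mult_ac)
  also have "\<dots> = 6 * (y * z) * (a + s)" by simp
  also have "\<dots> \<le> (a * K / 2) * (a + s)" using K s by (intro mult_right_mono) auto
  also have "\<dots> = a * (a + b + c) * (K / 2)" by (simp add: s_def algebra_simps)
  also have "\<dots> < 2 * (sqrt 3 * S) * (K / 2)"
    using S_lower \<open>0 < K\<close> by (intro mult_strict_right_mono) auto
  also have "\<dots> = sqrt 3 * (S * K)" by simp
  finally have *: "2 * sqrt 3 * (y * z) * (a + s) < S * K" by simp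
  have 1: "y * ((c + a) * v) - z * ((a + b) * u) = d * K / 2"
    by (simp add: K_def s_def d_def u_def v_def y_def z_def power2_eq_square field_simps)
  have 2: "(a + b) * u - (c + a) * v = d * (a + s)"
    by (simp add: s_def d_def u_def v_def power2_eq_square algebra_simps)
  have "(S + sqrt 3 * z) * (y * (c + a) * v) - z * (a + b) * u * (S + sqrt 3 * y)
      = S * (y * ((c + a) * v) - z * ((a + b) * u)) - sqrt 3 * (y * z) * ((a + b) * u - (c + a) * v)"
    by (simp add: algebra_simps)
  also have "\<dots> = d * (S * K - 2 * sqrt 3 * (y * z) * (a + s)) / 2"
    unfolding 1 2 by (simp add: field_simps)
  also have "\<dots> > 0" using * d by simp
  finally show "z * (a + b) * u * (S + sqrt 3 * y) < (S + sqrt 3 * z) * (y * (c + a) * v)" by simp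
qed (simp_all add: add_pos_pos)

section \<open>Comparisons from X(29) to X(23)\<close>

lemma t_29_4: "t 4 < t 29"
  unfolding t_4 t_29
proof (rule atrace_signed_dist_less)
  have "(a + b) * u - (c + a) * v = (c - b) * (a + b + c)"
    by (simp add: u_def v_def power2_eq_square algebra_simps)
  also have "\<dots> > 0" using bc pos(1-3) by simp
  finally have "z * y * ((c + a) * v) < z * y * ((a + b) * u)" by simp
  then show "z * (y * (c + a) * v) < z * (a + b) * u * y" by (simp add: ac_simps)
qed (simp_all add: add_pos_pos)

text \<open>Adding \<open>a\<close> to both terms moves the ratio \<open>b / c\<close> towards 1.
  This separates X(27) from X(19) and X(28) from X(25).\<close>

lemma b_ca_less_c_ab: "b * (c + a) < c * (a + b)"
  using bc by (simp add: algebra_simps)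

lemma t_4_27: "t 27 < t 4"
  unfolding t_4 t_27 by (rule atrace_signed_dist_less) (simp_all add: add_pos_pos bc)

lemma t_27_19: "t 19 < t 27"
  unfolding t_19 t_27
proof (rule atrace_signed_dist_less)
  have "y * z * (b * (c + a)) < y * z * (c * (a + b))" using b_ca_less_c_ab by simp
  then show "b * z * (y * (c + a)) < z * (a + b) * (c * y)" by (simp add: ac_simps)
qed (simp_all add: add_pos_pos)

lemma t_19_28: "t 28 < t 19"
  unfolding t_19 t_28 by (rule atrace_signed_dist_less) (simp_all add: add_pos_pos bc)

lemma t_28_25: "t 25 < t 28"
  unfolding t_25 t_28
proof (rule atrace_signed_dist_less)
  have "b * c * y * z * (b * (c + a)) < b * c * y * z * (c * (a + b))" using b_ca_less_c_ab by simp
  then show "b^2 * z * (c * y * (c + a)) < b * z * (a + b) * (c^2 * y)"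
    by (simp add: ac_simps power2_eq_square)
qed (simp_all add: add_pos_pos)

text \<open>The brackets are positive multiples of -cos 2B and -cos 2C. Both are positive, that is,
  B and C exceed 45 degrees, because \<open>x\<close> is the largest of \<open>x\<close>,
  \<open>y\<close>, \<open>z\<close>.\<close>

lemma t_24_sum_pos: "0 < b^2 * z * (c^2 * a^2 - 2 * y^2) + c^2 * y * (a^2 * b^2 - 2 * z^2)"
proof -
  have "c^2 * a^2 - 2 * y^2 = y * (x - y) + z * x + y * z"
    "a^2 * b^2 - 2 * z^2 = z * (x - z) + x * y + y * z"
    unfolding side_sq by (simp_all add: power2_eq_square algebra_simps)
  then show ?thesis using xyz_order by (simp add: add_pos_pos)
qed

lemma t_25_24: "t 24 < t 25"
  unfolding t_24 t_25
proof (rule atrace_signed_dist_less)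
  have "(a^2 * b^2 - 2 * z^2) - (c^2 * a^2 - 2 * y^2) = (y - z) * (y + z)"
    unfolding side_sq by (simp add: power2_eq_square algebra_simps)
  also have "\<dots> > 0" using xyz_order by (simp add: add_pos_pos)
  finally have "b^2 * c^2 * y * z * (c^2 * a^2 - 2 * y^2) < b^2 * c^2 * y * z * (a^2 * b^2 - 2 * z^2)"
    by simp
  then show "b^2 * z * (c^2 * a^2 - 2 * y^2) * (c^2 * y) < b^2 * z * (c^2 * y * (a^2 * b^2 - 2 * z^2))"
    by (simp add: ac_simps)
qed (simp_all add: add_pos_pos t_24_sum_pos)

lemma t_24_23: "t 23 < t 24"
  unfolding t_23 t_24
proof (rule atrace_signed_dist_less[OF _ t_24_sum_pos])
  let ?q = "b^2 * (3 * z * x - y^2 - x * y - y * z)" and ?r = "c^2 * (3 * x * y - z^2 - z * x - y * z)"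
  let ?q' = "b^2 * z * (c^2 * a^2 - 2 * y^2)" and ?r' = "c^2 * y * (a^2 * b^2 - 2 * z^2)"
  \<comment> \<open>Grouped by \<open>x - z\<close> and \<open>x - y\<close>, both positive, since
    \<open>?q\<close> alone can be negative.\<close>
  have "?q + ?r = 2 * (y^2 * (x - z) + z^2 * (x - y) + x * (y * (x - z) + z * (x - y)))"
    unfolding side_sq by (simp add: power2_eq_square algebra_simps)
  also have "\<dots> > 0" using xyz_order by (simp add: add_pos_pos)
  finally show "0 < ?q + ?r" .
  have "?q' * ?r - ?q * ?r' = (z + x) * (x + y) * (y - z) *
      (x^2 * (y + z)^2 + 2 * x * y * z * (y + z) + x * (y + z) * (y - z)^2 + y * z * (y + z)^2)"
    unfolding side_sq by (simp add: power2_eq_square algebra_simps)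
  also have "\<dots> > 0"
  proof -
    have "0 < y + z" by (simp add: add_pos_pos)
    then show ?thesis using xyz_order
      by (intro mult_pos_pos add_pos_pos zero_less_power) simp_all
  qed
  finally show "?q * ?r' < ?q' * ?r" by simp
qed simp

end

theorem theorem6p4:
  fixes a b c :: real
  assumes "acute_abc a b c" and "a < b" and "b < c"
  defines "t \<equiv> \<lambda>n. atrace_signed_dist a (etc_center n a b c)"
  shows "t 20 > t 22 \<and> t 22 > t 3 \<and> t 3 > t 8 \<and> t 8 > t 9 \<and> t 9 > t 21 \<and>
         t 21 > t 10 \<and> t 10 > t 2 \<and> t 2 > t 1 \<and> t 1 > t 17 \<and> t 17 > t 12 \<and>
         t 12 > t 7 \<and> t 7 > t 13 \<and> t 13 > t 29 \<and> t 29 > t 4 \<and> t 4 > t 27 \<and>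
         t 27 > t 19 \<and> t 19 > t 28 \<and> t 28 > t 25 \<and> t 25 > t 24 \<and> t 24 > t 23"
proof -
  interpret T: ordered_acute_triangle a b c
    using assms by unfold_locales
  have "t = T.t" by (simp add: t_def T.t_def fun_eq_iff)
  then show ?thesis
    using T.t_20_22 T.t_22_3 T.t_3_8 T.t_8_9 T.t_9_21 T.t_21_10 T.t_10_2 T.t_2_1 T.t_1_17
      T.t_17_12 T.t_12_7 T.t_7_13 T.t_13_29 T.t_29_4 T.t_4_27 T.t_27_19 T.t_19_28 T.t_28_25
      T.t_25_24 T.t_24_23 by simp
qed

end
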